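(* The social welfare functional $\mathit{mm}$ (Maximin) is Pascalian; that is, $\mathit{mm}$ is $k$-fanatical for every real $k \in (0, 0.5)$.
   Context: **Ethical frameworks.** Let $A$ be a set of actions. An ethical theory on $A$ is a function $t: A \to \mathbb{R}$. An ethical framework is a pair $F = (T, c)$ where $T$ is a finite set of ethical theories on $A$ and $c: T \to (0,1]$ is a credence function with $\sum_{t \in T} c(t) = 1$. **Social welfare functionals.** A social welfare functional $f$ assigns to every set of actions $A$ and every ethical framework $F$ on $A$ a total preorder $f(F, A)$ on $A$ (a complete, reflexive, transitive relation; ties are allowed). Two such orderings are equal iff they are equal as relations on $A$. **Maximin.** For $F = (T,c)$, $\mathit{mm}(F,A) = \preceq_{\mathit{mm}}$ where, for $a, b \in A$, $a \preceq_{\mathit{mm}} b$ iff $\min_{t \in T} t(a) \le \min_{t \in T} t(b)$. **Restriction.** Given $F = (T,c)$ and a subset $T' \subset T$, the framework obtained by restricting $F$ to $T'$ is $(T', c')$ with $c'(t) = c(t) / \sum_{s \in T'} c(s)$ for $t \in T'$. **Extension.** Given $F = (T,c)$ and $T' \supset T$, a framework $F' = (T', c')$ is obtained by extending $F$ with $T'$ if for every $t \in T$, $c'(t) = n \cdot c(t)$, where $n = \frac{1 - \sum_{s \in T' \setminus T} c'(s)}{\sum_{s \in T} c(s)}$. (There are multiple ways of extending $F$ with $T'$, individuated by the credences $c'$ of the theories in $T' \setminus T$.) **Dominant subset.** Let $F = (T,c)$ be a framework, $A$ a set of actions and $f$ a social welfare functional. A subset $T_d \subset T$ is a dominant subset (given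 $F$, $A$, $f$) if $f(F,A) = f(F_d,A)$ and $f(F_d,A) \neq f(F_y,A)$, where $F_d$ is $F$ restricted to $T_d$ and $F_y$ is $F$ restricted to $T \setminus T_d$. **Fanaticism.** For $k \in (0,0.5)$, a social welfare functional $f$ is $k$-fanatical if for any set of actions $A$ and any ethical framework $F_y = (T_y, c_y)$ on $A$, there exists a framework $F = (T,c)$ obtained by extending $F_y$ with $T = T_d \cup T_y$, where $T_d \neq \emptyset$ is a set of theories disjoint from $T_y$ that is a dominant subset given $F$, $A$ and $f$, and $\sum_{t \in T_d} c(t) \le k$. A social welfare functional is Pascalian if it is $k$-fanatical for any $k \in (0,0.5)$.
   Formalization: Fanaticism is required only for sets of actions A with at least two distinct actions; on an empty or one-element A there is only one total preorder, so no dominant subset can exist and the claim as written fails. *)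

theory Defs
  imports Complex_Main "HOL-Library.FuncSet"
begin

type_synonym 'a ethical_theory = "'a \<Rightarrow> real"

text \<open>
  Functions on a set of actions, and credence functions on a set of theories, are extensional
  (\<open>undefined\<close> outside their domain), so that equality of HOL functions is equality of functions
  on the given domain, and disjointness of two sets of theories means what it should.
\<close>

type_synonym 'a framework = "'a ethical_theory set \<times> ('a ethical_theory \<Rightarrow> real)"

abbreviation theories :: "'a framework \<Rightarrow> 'a ethical_theory set" where
  "theories \<equiv> fst"

abbreviation credence :: "'a framework \<Rightarrow> 'a ethical_theory \<Rightarrow> real" where
  "credence \<equiv> snd"

definition ethical_theories :: "'a set \<Rightarrow> 'a ethical_theory set" where
  "ethical_theories A = A \<rightarrow>\<^sub>E (UNIV :: real set)"

definition ethical_framework :: "'a set \<Rightarrow> 'a framework \<Rightarrow> bool" where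
  "ethical_framework A F \<longleftrightarrow>
     finite (theories F) \<and> theories F \<subseteq> ethical_theories A \<and>
     credence F \<in> theories F \<rightarrow>\<^sub>E {0<..1} \<and>
     (\<Sum>t\<in>theories F. credence F t) = 1"

text \<open>An ordering is the set of pairs \<open>(a, b)\<close> such that \<open>a\<close> is ranked weakly below \<open>b\<close>.\<close>

definition total_preorder_on :: "'a set \<Rightarrow> 'a rel \<Rightarrow> bool" where
  "total_preorder_on A r \<longleftrightarrow> preorder_on A r \<and> total_on A r"

definition social_welfare_functional :: "('a framework \<Rightarrow> 'a set \<Rightarrow> 'a rel) \<Rightarrow> bool" where
  "social_welfare_functional f \<longleftrightarrow>
     (\<forall>A F. ethical_framework A F \<longrightarrow> total_preorder_on A (f F A))"

definition maximin :: "'a framework \<Rightarrow> 'a set \<Rightarrow> 'a rel" where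
  "maximin F A =
     {(a, b) \<in> A \<times> A. Min ((\<lambda>t. t a) ` theories F) \<le> Min ((\<lambda>t. t b) ` theories F)}"

definition restrict_framework ::
    "'a framework \<Rightarrow> 'a ethical_theory set \<Rightarrow> 'a framework" where
  "restrict_framework F T' =
     (T', \<lambda>t\<in>T'. credence F t / (\<Sum>s\<in>T'. credence F s))"

definition obtained_by_extending ::
    "'a set \<Rightarrow> 'a framework \<Rightarrow> 'a framework \<Rightarrow> 'a ethical_theory set \<Rightarrow> bool" where
  "obtained_by_extending A F' F T' \<longleftrightarrow>
     ethical_framework A F' \<and> theories F' = T' \<and> theories F \<subset> T' \<and>
     (let n = (1 - (\<Sum>s\<in>T' - theories F. credence F' s)) / (\<Sum>s\<in>theories F. credence F s)
      in \<forall>t\<in>theories F. credence F' t = n * credence F t)"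

text \<open>
  Proper inclusion makes the complement nonempty; a framework cannot have an empty set of theories.
\<close>

definition dominant_subset ::
    "'a framework \<Rightarrow> 'a set \<Rightarrow> ('a framework \<Rightarrow> 'a set \<Rightarrow> 'a rel) \<Rightarrow>
     'a ethical_theory set \<Rightarrow> bool" where
  "dominant_subset F A f T\<^sub>d \<longleftrightarrow>
     T\<^sub>d \<subset> theories F \<and>
     f F A = f (restrict_framework F T\<^sub>d) A \<and>
     f (restrict_framework F T\<^sub>d) A \<noteq> f (restrict_framework F (theories F - T\<^sub>d)) A"

text \<open>
  Sets of actions are required to contain two distinct actions. On an empty or one-element set
  there is only one total preorder, so that no dominant subset exists, and without this
  requirement no social welfare functional would be fanatical. No other condition is put on the
  set of actions; in particular it may be infinite.
\<close>

definition fanatical :: "real \<Rightarrow> ('a framework \<Rightarrow> 'a set \<Rightarrow> 'a rel) \<Rightarrow> bool" where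
  "fanatical k f \<longleftrightarrow>
     social_welfare_functional f \<and>
     (\<forall>A F\<^sub>y. (\<exists>a\<in>A. \<exists>b\<in>A. a \<noteq> b) \<longrightarrow> ethical_framework A F\<^sub>y \<longrightarrow>
        (\<exists>F T\<^sub>d. T\<^sub>d \<noteq> {} \<and> T\<^sub>d \<inter> theories F\<^sub>y = {} \<and>
           obtained_by_extending A F F\<^sub>y (T\<^sub>d \<union> theories F\<^sub>y) \<and>
           dominant_subset F A f T\<^sub>d \<and>
           (\<Sum>t\<in>T\<^sub>d. credence F t) \<le> k))"

definition pascalian :: "('a framework \<Rightarrow> 'a set \<Rightarrow> 'a rel) \<Rightarrow> bool" where
  "pascalian f \<longleftrightarrow> (\<forall>k. 0 < k \<and> k < 1/2 \<longrightarrow> fanatical k f)"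

end

theory Submission
  imports Defs
begin

text \<open>
  Let \<open>m\<close> be the pointwise minimum of the given theories and let \<open>a \<noteq> b\<close> be actions with
  \<open>m a \<le> m b\<close>. The theory equal to \<open>m - 1\<close> everywhere except at \<open>b\<close>, where it is \<open>m a - 2\<close>, lies
  strictly below \<open>m\<close>. Added with any positive credence it therefore determines maximin on its own,
  and it ranks \<open>b\<close> strictly below \<open>a\<close>, contrary to \<open>m\<close>.
\<close>

lemma social_welfare_functional_maximin: "social_welfare_functional maximin"
  unfolding social_welfare_functional_def total_preorder_on_def preorder_on_def
    refl_on_def trans_def total_on_def maximin_def
  by auto

text \<open>Maximin depends only on the set of theories, so the renormalised credences can be
  replaced by any \<open>c\<close>.\<close>

lemma maximin_restrict_framework:
  "maximin (restrict_framework F T) A = maximin (T, c) A"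
  by (simp add: maximin_def restrict_framework_def)

lemma maximin_singleton: "maximin ({t}, c) A = {(a, b) \<in> A \<times> A. t a \<le> t b}"
  by (simp add: maximin_def)

text \<open>At every action in \<open>A\<close> the minimum over \<open>insert t T\<close> is
  attained at \<open>t\<close>.\<close>

lemma maximin_insert_below:
  assumes "finite T" and "\<And>s x. s \<in> T \<Longrightarrow> x \<in> A \<Longrightarrow> t x \<le> s x"
  shows "maximin (insert t T, c) A = maximin ({t}, d) A"
proof -
  have "Min ((\<lambda>s. s x) ` insert t T) = t x" if "x \<in> A" for x
    using assms that by (intro Min_eqI) auto
  then show ?thesis
    unfolding maximin_singleton by (auto simp: maximin_def simp del: image_insert)
qed

lemma exists_theory_below_reversing_maximin:
  assumes "finite T" and "a \<in> A" and "b \<in> A" and "a \<noteq> b"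
  obtains t where "t \<in> ethical_theories A"
    and "\<And>s x. s \<in> T \<Longrightarrow> x \<in> A \<Longrightarrow> t x < s x"
    and "maximin ({t}, c) A \<noteq> maximin (T, d) A"
proof -
  define m where "m x = Min ((\<lambda>s. s x) ` T)" for x
  have m_le: "m x \<le> s x" if "s \<in> T" for s x
    unfolding m_def using assms(1) that by simp
  \<comment> \<open>The actions \<open>u\<close> and \<open>v\<close> will be \<open>a\<close> and
    \<open>b\<close>, in whichever order gives \<open>m u \<le> m v\<close>.\<close>
  have wlog: thesis if uv: "u \<in> A" "v \<in> A" "u \<noteq> v" "m u \<le> m v" for u v
  proof
    \<comment> \<open>Since \<open>m u \<le> m v\<close>, the value \<open>m u - 2\<close> at
      \<open>v\<close> is below \<open>m v\<close>; it is also below \<open>t u = m u - 1\<close>,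
      which reverses the ranking of \<open>u\<close> and \<open>v\<close>.\<close>
    define t where "t = (\<lambda>x\<in>A. if x = v then m u - 2 else m x - 1)"
    show "t \<in> ethical_theories A"
      unfolding ethical_theories_def t_def by simp
    show "t x < s x" if "s \<in> T" "x \<in> A" for s x
      using m_le[OF that(1), of x] that(2) uv(4) by (auto simp: t_def)
    have "(u, v) \<in> maximin (T, d) A"
      using uv by (simp add: maximin_def m_def)
    moreover have "(u, v) \<notin> maximin ({t}, c) A"
      using uv by (simp add: maximin_singleton t_def)
    ultimately show "maximin ({t}, c) A \<noteq> maximin (T, d) A"
      by blast
  qed
  show thesis
    using linear[of "m a" "m b"] wlog[of a b] wlog[of b a] assms(2-4) by blast
qed

text \<open>Giving \<open>t\<close> credence \<open>k\<close> and scaling the old credences by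
  \<open>1 - k\<close> keeps the total at 1. As the old credences sum to 1, the factor
  \<open>n\<close> in the definition of an extension is exactly \<open>1 - k\<close>.\<close>

lemma obtained_by_extending_insert:
  assumes "ethical_framework A F" and "t \<in> ethical_theories A" and "t \<notin> theories F"
    and "0 < k" and "k < 1"
  shows "obtained_by_extending A
    (insert t (theories F),
      \<lambda>s\<in>insert t (theories F). if s = t then k else (1 - k) * credence F s)
    F (insert t (theories F))"
proof -
  obtain T c where F: "F = (T, c)" by (cases F)
  have T: "finite T" "T \<subseteq> ethical_theories A" "c \<in> T \<rightarrow>\<^sub>E {0<..1}" "sum c T = 1" "t \<notin> T"
    using assms by (auto simp: ethical_framework_def F)
  define c' where "c' = (\<lambda>s\<in>insert t T. if s = t then k else (1 - k) * c s)"
  have c't: "c' t = k" by (simp add: c'_def)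
  have c'T: "c' s = (1 - k) * c s" if "s \<in> T" for s
    using that T by (auto simp: c'_def)
  have "(1 - k) * c s \<in> {0<..1}" if "s \<in> T" for s
  proof -
    have "0 < c s" "c s \<le> 1" using T(3) that by (auto simp: PiE_iff)
    then show ?thesis using assms(4,5) by (simp add: mult_le_one)
  qed
  then have c': "c' \<in> insert t T \<rightarrow>\<^sub>E {0<..1}"
    using assms(4,5) by (auto simp: c'_def PiE_iff)
  have "sum c' T = 1 - k"
    using c'T T by (simp flip: sum_distrib_left)
  then have "ethical_framework A (insert t T, c')"
    using T c' c't assms(2) by (simp add: ethical_framework_def)
  moreover have "insert t T - T = {t}"
    using T by auto
  moreover have "T \<subset> insert t T"
    using T by auto
  ultimately show ?thesis
    using T(4) c't c'T unfolding F fst_conv snd_conv c'_def[symmetric] obtained_by_extending_def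
    by simp
qed

theorem theorem13:
  shows "pascalian (maximin :: 'a framework \<Rightarrow> 'a set \<Rightarrow> 'a rel)"
  unfolding pascalian_def fanatical_def
proof (intro allI impI conjI)
  show "social_welfare_functional (maximin :: 'a framework \<Rightarrow> 'a set \<Rightarrow> 'a rel)"
    by (rule social_welfare_functional_maximin)
next
  fix k :: real and A :: "'a set" and F\<^sub>y :: "'a framework"
  assume k: "0 < k \<and> k < 1/2"
    and "\<exists>a\<in>A. \<exists>b\<in>A. a \<noteq> b"
    and framework: "ethical_framework A F\<^sub>y"
  then obtain a b where ab: "a \<in> A" "b \<in> A" "a \<noteq> b" by blast
  let ?T = "theories F\<^sub>y"
  \<comment> \<open>An empty set of theories would have total credence 0, not 1.\<close>
  have T: "finite ?T" "?T \<noteq> {}"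
    using framework by (auto simp: ethical_framework_def)
  obtain t where t: "t \<in> ethical_theories A"
    and below: "\<And>s x. s \<in> ?T \<Longrightarrow> x \<in> A \<Longrightarrow> t x < s x"
    and reverses: "maximin ({t}, credence F\<^sub>y) A \<noteq> maximin (?T, credence F\<^sub>y) A"
    by (rule exists_theory_below_reversing_maximin[OF T(1) ab,
          where c = "credence F\<^sub>y" and d = "credence F\<^sub>y"])
      blast
  \<comment> \<open>Otherwise \<open>below\<close> with \<open>s = t\<close> would give
    \<open>t a < t a\<close>.\<close>
  have t_notin: "t \<notin> ?T"
    using below ab(1) by blast
  define c where "c = (\<lambda>s\<in>insert t ?T. if s = t then k else (1 - k) * credence F\<^sub>y s)"
  let ?F = "(insert t ?T, c)"
  have "obtained_by_extending A ?F F\<^sub>y ({t} \<union> ?T)"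
    using obtained_by_extending_insert[OF framework t t_notin] k by (simp add: c_def)
  moreover have "maximin ?F A = maximin ({t}, credence F\<^sub>y) A"
    using maximin_insert_below[OF T(1)] below by (simp add: less_imp_le)
  \<comment> \<open>The complement of \<open>{t}\<close> in \<open>insert t ?T\<close> is
    \<open>?T\<close>, whose ordering differs by \<open>reverses\<close>; the inclusion is proper
    because \<open>?T\<close> is nonempty.\<close>
  then have "dominant_subset ?F A maximin {t}"
    unfolding dominant_subset_def
      maximin_restrict_framework[where c = "credence F\<^sub>y"]
    using T(2) t_notin reverses by auto
  moreover have "(\<Sum>s\<in>{t}. credence ?F s) \<le> k"
    by (simp add: c_def)
  ultimately show "\<exists>F T\<^sub>d. T\<^sub>d \<noteq> {} \<and> T\<^sub>d \<inter> ?T = {} \<and>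
      obtained_by_extending A F F\<^sub>y (T\<^sub>d \<union> ?T) \<and>
      dominant_subset F A maximin T\<^sub>d \<and> (\<Sum>s\<in>T\<^sub>d. credence F s) \<le> k"
    using t_notin by (intro exI[of _ ?F] exI[of _ "{t}"]) simp
qed

end
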